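(* There is, up to equivalence, exactly one extension $0\to\mathbb{Z}/2\to L\to\mathbb{Z}/3\to 0$ with trivial action such that $L$ is a left Bol loop.
   Context: A loop is a set with a binary operation having a two-sided neutral element and such that all left and right translations are bijective. A loop is left Bol if $y(x\cdot yz)=(y\cdot xy)z$ for all $x,y,z$. An extension $0\to Z\to L\to Q\to 0$ of a loop $Q$ by a commutative group $Z$ with trivial action is a loop $L$ with an injective homomorphism $Z\to L$ (we identify $Z$ with its image) and a surjective loop homomorphism $j:L\to Q$ whose kernel $\{\ell: j(\ell)=e\}$ is $Z$, such that the elements of $Z$ associate with all elements of $L$ (that is, $(uv)w=u(vw)$ whenever at least one of $u,v,w$ lies in $Z$) and (triviality of the action) $z\ell=\ell z$ for all $z\in Z,\ell\in L$. Two extensions $L,M$ are equivalent if there is a loop homomorphism $M\to L$ that restricts to the identity on $Z$ and commutes with the projections to $Q$. *)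

theory Defs
  imports "HOL-Algebra.Algebra"
begin

locale loop =
  fixes L (structure)
  assumes one_closed [intro, simp]: "\<one> \<in> carrier L"
    and m_closed [intro, simp]: "\<lbrakk>x \<in> carrier L; y \<in> carrier L\<rbrakk> \<Longrightarrow> x \<otimes> y \<in> carrier L"
    and l_one [simp]: "x \<in> carrier L \<Longrightarrow> \<one> \<otimes> x = x"
    and r_one [simp]: "x \<in> carrier L \<Longrightarrow> x \<otimes> \<one> = x"
    and bij_left_translation:
      "x \<in> carrier L \<Longrightarrow> bij_betw (\<lambda>y. x \<otimes> y) (carrier L) (carrier L)"
    and bij_right_translation:
      "x \<in> carrier L \<Longrightarrow> bij_betw (\<lambda>y. y \<otimes> x) (carrier L) (carrier L)"

locale left_bol_loop = loop +
  assumes left_bol: "\<lbrakk>x \<in> carrier L; y \<in> carrier L; z \<in> carrier L\<rbrakk> \<Longrightarrow>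
    y \<otimes> (x \<otimes> (y \<otimes> z)) = (y \<otimes> (x \<otimes> y)) \<otimes> z"

(* hom only requires compatibility with the products; between loops, preservation of the
   neutral element follows by cancellation. *)
locale loop_extension = Z: comm_group Z + Q: loop Q + L: loop L
  for Z :: "('z, 'zm) monoid_scheme" (structure)
    and L :: "('l, 'lm) monoid_scheme" (structure)
    and Q :: "('q, 'qm) monoid_scheme" (structure)
    and i :: "'z \<Rightarrow> 'l" and j :: "'l \<Rightarrow> 'q" +
  assumes i_hom: "i \<in> hom Z L"
    and i_inj: "inj_on i (carrier Z)"
    and j_hom: "j \<in> hom L Q"
    and j_surj: "j ` carrier L = carrier Q"
    and exact: "kernel L Q j = i ` carrier Z"
    and kernel_assoc:
      "\<lbrakk>u \<in> carrier L; v \<in> carrier L; w \<in> carrier L;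
        u \<in> i ` carrier Z \<or> v \<in> i ` carrier Z \<or> w \<in> i ` carrier Z\<rbrakk> \<Longrightarrow>
       (u \<otimes>\<^bsub>L\<^esub> v) \<otimes>\<^bsub>L\<^esub> w = u \<otimes>\<^bsub>L\<^esub> (v \<otimes>\<^bsub>L\<^esub> w)"
    and trivial_action:
      "\<lbrakk>z \<in> carrier Z; l \<in> carrier L\<rbrakk> \<Longrightarrow> i z \<otimes>\<^bsub>L\<^esub> l = l \<otimes>\<^bsub>L\<^esub> i z"

(* Meaningful for two extensions (L, i, j) and (M, i', j') of the same loop by the same Z;
   Q itself is not needed, since it only enters as the common codomain of j and j'. *)
definition equivalent_extensions ::
  "('z, 'zm) monoid_scheme \<Rightarrow>
   ('l, 'lm) monoid_scheme \<Rightarrow> ('z \<Rightarrow> 'l) \<Rightarrow> ('l \<Rightarrow> 'q) \<Rightarrow>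
   ('m, 'mm) monoid_scheme \<Rightarrow> ('z \<Rightarrow> 'm) \<Rightarrow> ('m \<Rightarrow> 'q) \<Rightarrow> bool"
  where "equivalent_extensions Z L i j M i' j' \<longleftrightarrow>
    (\<exists>f \<in> hom M L. (\<forall>z \<in> carrier Z. f (i' z) = i z) \<and> (\<forall>m \<in> carrier M. j (f m) = j' m))"

end

theory Submission
  imports Defs
begin

text \<open>
  In a left Bol loop, setting \<open>x = \<one>\<close> in the Bol identity gives \<open>y (y z) = (y y) z\<close>. The
  uniqueness rests on this left alternative law. Let \<open>L\<close> be an extension of \<open>\<int>/3\<close> by \<open>Z\<close>,
  and let \<open>a\<close> lie over the generator \<open>1\<close>. Then \<open>a (a a)\<close> lies over \<open>0\<close>, hence in \<open>Z\<close>.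
  Multiplying \<open>a\<close> by an element \<open>w\<close> of \<open>Z\<close>
  multiplies \<open>a (a a)\<close> by \<open>w\<^sup>3\<close>; if every element of \<open>Z\<close> is a cube, as in \<open>\<int>/2\<close>, one can
  therefore arrange \<open>a (a a) = \<one>\<close>. Put \<open>b = a a\<close>. Left alternativity determines the remaining
  products, \<open>b a = a (a a) = \<one>\<close> and \<open>b b = a (a b) = a\<close>, so \<open>{\<one>, a, b}\<close> is a copy of \<open>\<int>/3\<close>
  inside \<open>L\<close>: the extension splits (\<open>left_bol_extension_splits\<close>).

  A split extension is the product of \<open>Z\<close> and \<open>Q\<close>, because \<open>Z\<close> is central and associates with
  everything; so any two split extensions are equivalent (\<open>split_extensions_equivalent\<close>). Existence
  is witnessed by the cyclic group \<open>\<int>/6\<close>.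
\<close>

section \<open>Splittings of central extensions\<close>

context loop
begin

lemma left_cancel:
  assumes "x \<in> carrier L" "y \<in> carrier L" "z \<in> carrier L" "x \<otimes> y = x \<otimes> z"
  shows "y = z"
  using assms bij_left_translation[of x] by (auto simp: bij_betw_def dest: inj_onD)

lemma right_cancel:
  assumes "x \<in> carrier L" "y \<in> carrier L" "z \<in> carrier L" "y \<otimes> x = z \<otimes> x"
  shows "y = z"
  using assms bij_right_translation[of x] by (auto simp: bij_betw_def dest: inj_onD)

lemma right_division:
  assumes "x \<in> carrier L" "y \<in> carrier L"
  obtains z where "z \<in> carrier L" "z \<otimes> x = y"
  using bij_right_translation[OF assms(1)] assms(2) unfolding bij_betw_def by (metis imageE)

lemma idempotent_is_one:
  assumes "x \<in> carrier L" "x \<otimes> x = x"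
  shows "x = \<one>"
  using left_cancel[of x x \<one>] assms by simp

end

lemma loop_hom_one:
  assumes "loop G" "loop H" "h \<in> hom G H"
  shows "h \<one>\<^bsub>G\<^esub> = \<one>\<^bsub>H\<^esub>"
proof (rule loop.idempotent_is_one[OF assms(2)])
  show "h \<one>\<^bsub>G\<^esub> \<in> carrier H"
    using assms loop.one_closed[OF assms(1)] by (simp add: hom_in_carrier)
  show "h \<one>\<^bsub>G\<^esub> \<otimes>\<^bsub>H\<^esub> h \<one>\<^bsub>G\<^esub> = h \<one>\<^bsub>G\<^esub>"
    using hom_mult[OF assms(3), of "\<one>\<^bsub>G\<^esub>" "\<one>\<^bsub>G\<^esub>"] loop.one_closed[OF assms(1)]
      loop.l_one[OF assms(1)] by simp
qed

context loop_extension
begin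

lemma i_closed [simp]: "z \<in> carrier Z \<Longrightarrow> i z \<in> carrier L"
  using i_hom by (rule hom_in_carrier)

lemma j_closed [simp]: "l \<in> carrier L \<Longrightarrow> j l \<in> carrier Q"
  using j_hom by (rule hom_in_carrier)

lemma j_i [simp]: "z \<in> carrier Z \<Longrightarrow> j (i z) = \<one>\<^bsub>Q\<^esub>"
  using exact by (auto simp: kernel_def)

lemma i_one: "i \<one> = \<one>\<^bsub>L\<^esub>"
proof (rule L.idempotent_is_one)
  show "i \<one> \<otimes>\<^bsub>L\<^esub> i \<one> = i \<one>"
    using hom_mult[OF i_hom, of \<one> \<one>] by simp
qed simp

lemma central_mult:
  assumes "z \<in> carrier Z" "w \<in> carrier Z" "x \<in> carrier L" "y \<in> carrier L"
  shows "(i z \<otimes>\<^bsub>L\<^esub> x) \<otimes>\<^bsub>L\<^esub> (i w \<otimes>\<^bsub>L\<^esub> y) = i (z \<otimes> w) \<otimes>\<^bsub>L\<^esub> (x \<otimes>\<^bsub>L\<^esub> y)"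
proof -
  have "(i z \<otimes>\<^bsub>L\<^esub> x) \<otimes>\<^bsub>L\<^esub> (i w \<otimes>\<^bsub>L\<^esub> y) = ((i z \<otimes>\<^bsub>L\<^esub> x) \<otimes>\<^bsub>L\<^esub> i w) \<otimes>\<^bsub>L\<^esub> y"
    using assms by (simp add: kernel_assoc)
  also have "(i z \<otimes>\<^bsub>L\<^esub> x) \<otimes>\<^bsub>L\<^esub> i w = i w \<otimes>\<^bsub>L\<^esub> (i z \<otimes>\<^bsub>L\<^esub> x)"
    using assms by (simp add: trivial_action)
  also have "\<dots> = (i w \<otimes>\<^bsub>L\<^esub> i z) \<otimes>\<^bsub>L\<^esub> x"
    using assms by (simp add: kernel_assoc)
  also have "i w \<otimes>\<^bsub>L\<^esub> i z = i (z \<otimes> w)"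
    using assms hom_mult[OF i_hom, of w z] by (simp add: Z.m_comm)
  also have "(i (z \<otimes> w) \<otimes>\<^bsub>L\<^esub> x) \<otimes>\<^bsub>L\<^esub> y = i (z \<otimes> w) \<otimes>\<^bsub>L\<^esub> (x \<otimes>\<^bsub>L\<^esub> y)"
    using assms by (simp add: kernel_assoc)
  finally show ?thesis .
qed

lemma same_fibre:
  assumes "x \<in> carrier L" "y \<in> carrier L" "j x = j y"
  obtains z where "z \<in> carrier Z" "y = i z \<otimes>\<^bsub>L\<^esub> x"
proof -
  obtain u where u: "u \<in> carrier L" "u \<otimes>\<^bsub>L\<^esub> x = y"
    using L.right_division[OF assms(1,2)] .
  have "j u \<otimes>\<^bsub>Q\<^esub> j x = \<one>\<^bsub>Q\<^esub> \<otimes>\<^bsub>Q\<^esub> j x"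
    using hom_mult[OF j_hom u(1) assms(1)] u assms by simp
  then have "j u = \<one>\<^bsub>Q\<^esub>"
    using Q.right_cancel[of "j x" "j u" "\<one>\<^bsub>Q\<^esub>"] u(1) assms by simp
  then have "u \<in> i ` carrier Z"
    using u(1) exact by (auto simp: kernel_def)
  then show thesis
    using that u(2) by blast
qed

end

text \<open>
  A splitting \<open>s\<close> lets one write each element uniquely as \<open>i z \<otimes> s q\<close>, and such elements multiply
  coordinatewise. The equivalence keeps both coordinates.
\<close>

lemma split_extensions_equivalent:
  fixes L (structure)
  assumes ext_L: "loop_extension Z L Q i j" and ext_M: "loop_extension Z M Q i' j'"
    and s: "s \<in> hom Q L" "\<And>q. q \<in> carrier Q \<Longrightarrow> j (s q) = q"
    and s': "s' \<in> hom Q M" "\<And>q. q \<in> carrier Q \<Longrightarrow> j' (s' q) = q"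
  shows "equivalent_extensions Z L i j M i' j'"
proof -
  interpret L: loop_extension Z L Q i j by (fact ext_L)
  interpret M: loop_extension Z M Q i' j' by (fact ext_M)
  have sc: "s q \<in> carrier L" "s' q \<in> carrier M" if "q \<in> carrier Q" for q
    using that s(1) s'(1) by (auto intro: hom_in_carrier)
  have "\<exists>z \<in> carrier Z. m = i' z \<otimes>\<^bsub>M\<^esub> s' (j' m)" if "m \<in> carrier M" for m
    using M.same_fibre[of "s' (j' m)" m] that sc s'(2) by (metis M.j_closed)
  then obtain p where p: "\<And>m. m \<in> carrier M \<Longrightarrow> p m \<in> carrier Z"
      "\<And>m. m \<in> carrier M \<Longrightarrow> i' (p m) \<otimes>\<^bsub>M\<^esub> s' (j' m) = m"
    by metis
  have p_unique: "p m = z"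
    if "m \<in> carrier M" "z \<in> carrier Z" "i' z \<otimes>\<^bsub>M\<^esub> s' (j' m) = m" for m z
  proof -
    have "i' (p m) = i' z"
      using M.L.right_cancel[of "s' (j' m)" "i' (p m)" "i' z"] that p sc by simp
    then show ?thesis
      using M.i_inj p(1) that by (auto dest: inj_onD)
  qed
  have p_mult: "p (m \<otimes>\<^bsub>M\<^esub> n) = p m \<otimes>\<^bsub>Z\<^esub> p n" if mn: "m \<in> carrier M" "n \<in> carrier M" for m n
  proof (rule p_unique)
    show "i' (p m \<otimes>\<^bsub>Z\<^esub> p n) \<otimes>\<^bsub>M\<^esub> s' (j' (m \<otimes>\<^bsub>M\<^esub> n)) = m \<otimes>\<^bsub>M\<^esub> n"
      using M.central_mult[of "p m" "p n" "s' (j' m)" "s' (j' n)"] mn p sc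
        hom_mult[OF M.j_hom, of m n] hom_mult[OF s'(1), of "j' m" "j' n"] by simp
  qed (use mn p in simp_all)
  define f where "f m = i (p m) \<otimes> s (j' m)" for m
  have "f \<in> hom M L"
  proof (rule homI)
    fix m n assume mn: "m \<in> carrier M" "n \<in> carrier M"
    show "f (m \<otimes>\<^bsub>M\<^esub> n) = f m \<otimes> f n"
      using L.central_mult[of "p m" "p n" "s (j' m)" "s (j' n)"] mn p sc
        hom_mult[OF M.j_hom, of m n] hom_mult[OF s(1), of "j' m" "j' n"] p_mult
      by (simp add: f_def)
  qed (use p sc in \<open>simp add: f_def\<close>)
  moreover have "f (i' z) = i z" if "z \<in> carrier Z" for z
  proof -
    have "p (i' z) = z"
      using that loop_hom_one[OF L.Q.loop_axioms M.L.loop_axioms s'(1)] by (intro p_unique) simp_all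
    then show ?thesis
      using that loop_hom_one[OF L.Q.loop_axioms L.L.loop_axioms s(1)] by (simp add: f_def)
  qed
  moreover have "j (f m) = j' m" if "m \<in> carrier M" for m
    using that p sc s(2) hom_mult[OF L.j_hom, of "i (p m)" "s (j' m)"] by (simp add: f_def)
  ultimately show ?thesis
    unfolding equivalent_extensions_def by blast
qed

section \<open>Left Bol extensions of the cyclic group of order three\<close>

lemma (in left_bol_loop) left_alternative:
  assumes "y \<in> carrier L" "z \<in> carrier L"
  shows "y \<otimes> (y \<otimes> z) = (y \<otimes> y) \<otimes> z"
  using left_bol[of \<one> y z] assms by simp

lemma left_bol_extension_splits:
  assumes ext: "loop_extension Z L (integer_mod_group 3) i j" and bol: "left_bol_loop L"
    and cubes: "\<And>z. z \<in> carrier Z \<Longrightarrow> \<exists>w \<in> carrier Z. w \<otimes>\<^bsub>Z\<^esub> (w \<otimes>\<^bsub>Z\<^esub> w) = z"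
  obtains s where "s \<in> hom (integer_mod_group 3) L"
    "\<And>q. q \<in> carrier (integer_mod_group 3) \<Longrightarrow> j (s q) = q"
proof -
  interpret loop_extension Z L "integer_mod_group 3" i j by (fact ext)
  interpret B: left_bol_loop L by (fact bol)
  have C: "carrier (integer_mod_group 3) = {0, 1, 2}"
    by (auto simp: carrier_integer_mod_group)
  obtain a0 where a0: "a0 \<in> carrier L" "j a0 = 1"
    using j_surj C by (metis imageE insertCI)
  have j_cube: "j (a0 \<otimes>\<^bsub>L\<^esub> (a0 \<otimes>\<^bsub>L\<^esub> a0)) = 0"
    using a0 by (simp add: hom_mult[OF j_hom] mult_integer_mod_group)
  have j_one: "j \<one>\<^bsub>L\<^esub> = 0"
    using j_i[of "\<one>\<^bsub>Z\<^esub>"] by (simp add: i_one)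
  obtain c where c: "c \<in> carrier Z" "\<one>\<^bsub>L\<^esub> = i c \<otimes>\<^bsub>L\<^esub> (a0 \<otimes>\<^bsub>L\<^esub> (a0 \<otimes>\<^bsub>L\<^esub> a0))"
    using same_fibre[of "a0 \<otimes>\<^bsub>L\<^esub> (a0 \<otimes>\<^bsub>L\<^esub> a0)" "\<one>\<^bsub>L\<^esub>"] a0 j_cube j_one by auto
  obtain w where w: "w \<in> carrier Z" "w \<otimes>\<^bsub>Z\<^esub> (w \<otimes>\<^bsub>Z\<^esub> w) = c"
    using cubes c(1) by blast
  \<comment> \<open>Scaling by \<open>w\<close> multiplies the cube of \<open>a0\<close> by \<open>w\<^sup>3 = c\<close>, which makes it trivial.\<close>
  define a where "a = i w \<otimes>\<^bsub>L\<^esub> a0"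
  define b where "b = a \<otimes>\<^bsub>L\<^esub> a"
  have ab_closed [simp]: "a \<in> carrier L" "b \<in> carrier L"
    using a0 w by (simp_all add: a_def b_def)
  have ab: "a \<otimes>\<^bsub>L\<^esub> b = \<one>\<^bsub>L\<^esub>"
    using a0 c w by (simp add: a_def b_def central_mult)
  have ba: "b \<otimes>\<^bsub>L\<^esub> a = \<one>\<^bsub>L\<^esub>"
    using B.left_alternative[of a a] ab by (simp add: b_def)
  have bb: "b \<otimes>\<^bsub>L\<^esub> b = a"
    using B.left_alternative[of a b] ab by (simp add: b_def)
  have ja: "j a = 1"
    using a0 w hom_mult[OF j_hom, of "i w" a0] by (simp add: a_def)
  have jb: "j b = 2"
    using hom_mult[OF j_hom, of a a] ja by (simp add: b_def mult_integer_mod_group)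
  define s where "s q = (if q = 0 then \<one>\<^bsub>L\<^esub> else if q = 1 then a else b)" for q :: int
  show thesis
  proof (rule that[of s])
    show "s \<in> hom (integer_mod_group 3) L"
      using ab ba bb b_def[symmetric] by (auto simp: hom_def C s_def mult_integer_mod_group)
    show "j (s q) = q" if "q \<in> carrier (integer_mod_group 3)" for q
      using that j_one ja jb by (auto simp: C s_def)
  qed
qed

section \<open>The cyclic group of order six as an extension\<close>

lemma group_imp_left_bol_loop:
  assumes "group G"
  shows "left_bol_loop G"
proof -
  interpret group G by (fact assms)
  show ?thesis
  proof unfold_locales
    fix x assume x: "x \<in> carrier G"
    show "bij_betw (\<lambda>y. x \<otimes>\<^bsub>G\<^esub> y) (carrier G) (carrier G)"
      by (rule bij_betw_byWitness[where f' = "\<lambda>y. inv\<^bsub>G\<^esub> x \<otimes>\<^bsub>G\<^esub> y"])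
        (use x in \<open>auto simp: m_assoc[symmetric]\<close>)
    show "bij_betw (\<lambda>y. y \<otimes>\<^bsub>G\<^esub> x) (carrier G) (carrier G)"
      by (rule bij_betw_byWitness[where f' = "\<lambda>y. y \<otimes>\<^bsub>G\<^esub> inv\<^bsub>G\<^esub> x"])
        (use x in \<open>auto simp: m_assoc\<close>)
  qed (auto simp: m_assoc)
qed

lemma cyclic_six_extension:
  "loop_extension (integer_mod_group 2) (integer_mod_group 6) (integer_mod_group 3)
     (\<lambda>z. 3 * z) (\<lambda>x. x mod 3)"
proof -
  have C: "carrier (integer_mod_group 2) = {0, 1}" "carrier (integer_mod_group 3) = {0, 1, 2}"
    "carrier (integer_mod_group 6) = {0, 1, 2, 3, 4, 5}"
    by (auto simp: carrier_integer_mod_group)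
  have loop: "loop (integer_mod_group n)" for n
    using group_imp_left_bol_loop[of "integer_mod_group n"] by (simp add: left_bol_loop_def)
  interpret G: comm_group "integer_mod_group 6" by simp
  show ?thesis
  proof (intro loop_extension.intro loop_extension_axioms.intro)
    show "(\<lambda>z. 3 * z) \<in> hom (integer_mod_group 2) (integer_mod_group 6)"
      by (auto simp: hom_def C mult_integer_mod_group)
    show "inj_on ((*) 3) (carrier (integer_mod_group 2))"
      by (auto simp: inj_on_def)
    show "(\<lambda>x. x mod 3) \<in> hom (integer_mod_group 6) (integer_mod_group 3)"
      by (auto simp: hom_def C mult_integer_mod_group)
    show "(\<lambda>x. x mod 3) ` carrier (integer_mod_group 6) = carrier (integer_mod_group 3)"
      by (auto simp: C)
    show "kernel (integer_mod_group 6) (integer_mod_group 3) (\<lambda>x. x mod 3)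
        = (*) 3 ` carrier (integer_mod_group 2)"
      by (auto simp: kernel_def C)
    show "3 * z \<otimes>\<^bsub>integer_mod_group 6\<^esub> l = l \<otimes>\<^bsub>integer_mod_group 6\<^esub> (3 * z)"
      if "z \<in> carrier (integer_mod_group 2)" "l \<in> carrier (integer_mod_group 6)" for z l
      by (simp add: mult_integer_mod_group add.commute)
    show "(u \<otimes>\<^bsub>integer_mod_group 6\<^esub> v) \<otimes>\<^bsub>integer_mod_group 6\<^esub> w
        = u \<otimes>\<^bsub>integer_mod_group 6\<^esub> (v \<otimes>\<^bsub>integer_mod_group 6\<^esub> w)"
      if "u \<in> carrier (integer_mod_group 6)" "v \<in> carrier (integer_mod_group 6)"
        "w \<in> carrier (integer_mod_group 6)" for u v w
      using that by (rule G.m_assoc)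
  qed (use loop in simp_all)
qed

theorem theorem3:
  shows "(\<exists>(L :: int monoid) i j.
            loop_extension (integer_mod_group 2) L (integer_mod_group 3) i j \<and> left_bol_loop L) \<and>
         (\<forall>(L :: 'l monoid) i j (M :: 'm monoid) i' j'.
            loop_extension (integer_mod_group 2) L (integer_mod_group 3) i j \<and> left_bol_loop L \<and>
            loop_extension (integer_mod_group 2) M (integer_mod_group 3) i' j' \<and> left_bol_loop M \<longrightarrow>
            equivalent_extensions (integer_mod_group 2) L i j M i' j')"
proof (intro conjI allI impI; (elim conjE)?)
  show "\<exists>(L :: int monoid) i j.
      loop_extension (integer_mod_group 2) L (integer_mod_group 3) i j \<and> left_bol_loop L"
    using cyclic_six_extension group_imp_left_bol_loop[OF group_integer_mod_group] by blast
next
  fix L :: "'l monoid" and i j and M :: "'m monoid" and i' j'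
  assume L: "loop_extension (integer_mod_group 2) L (integer_mod_group 3) i j" "left_bol_loop L"
    and M: "loop_extension (integer_mod_group 2) M (integer_mod_group 3) i' j'" "left_bol_loop M"
  \<comment> \<open>In a group of order two each element is its own cube.\<close>
  have cubes: "\<exists>w \<in> carrier (integer_mod_group 2).
      w \<otimes>\<^bsub>integer_mod_group 2\<^esub> (w \<otimes>\<^bsub>integer_mod_group 2\<^esub> w) = z"
    if "z \<in> carrier (integer_mod_group 2)" for z
    using that by (intro bexI[of _ z]) (auto simp: carrier_integer_mod_group mult_integer_mod_group)
  obtain s where s: "s \<in> hom (integer_mod_group 3) L"
      "\<And>q. q \<in> carrier (integer_mod_group 3) \<Longrightarrow> j (s q) = q"
    using left_bol_extension_splits[OF L cubes] by blast
  obtain s' where s': "s' \<in> hom (integer_mod_group 3) M"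
      "\<And>q. q \<in> carrier (integer_mod_group 3) \<Longrightarrow> j' (s' q) = q"
    using left_bol_extension_splits[OF M cubes] by blast
  show "equivalent_extensions (integer_mod_group 2) L i j M i' j'"
    by (rule split_extensions_equivalent[OF L(1) M(1) s s'])
qed

end
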